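(* Let $2 \leq k \leq n-1$ and let $f, g$ be two continuous real-valued functions on $S^{n-1} \subset \mathbb{E}^n$. Assume that for any $k$-dimensional plane $\alpha \subset \mathbb{E}^n$ passing through the origin there is some vector $a_\alpha \in \alpha$ such that at least one of the following two equations holds: $$f(-u) + a_\alpha \cdot u = g(u) \quad \text{for all } u \in \alpha \cap S^{n-1},$$ or $$f(u) + a_\alpha \cdot u = g(u) \quad \text{for all } u \in \alpha \cap S^{n-1}.$$ Then there exists $b \in \mathbb{E}^n$ such that either $g(u) = f(u) + b \cdot u$ for all $u \in S^{n-1}$, or $g(u) = f(-u) + b \cdot u$ for all $u \in S^{n-1}$.
   Context: $\mathbb{E}^n$ is $n$-dimensional Euclidean space with scalar product $x \cdot y$, and $S^{n-1}$ is the set of its unit vectors. A $k$-dimensional plane through the origin is a $k$-dimensional linear subspace. *)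

theory Defs
  imports "HOL-Analysis.Analysis"
begin

end

theory Submission
  imports Defs
begin

text \<open>
  On every plane the hypothesis forces the even parts of \<open>f\<close> and \<open>g\<close> to agree, and it makes the odd
  part of \<open>g - f\<close> or the odd part of \<open>g + f\<close> the restriction of a linear functional. Let \<open>p\<close> and \<open>q\<close> be
  the extensions of these two odd parts (up to a factor 2) to functions that are homogeneous of degree
  one. Every two vectors lie in a common \<open>k\<close>-dimensional subspace, so on the span of any two vectors
  \<open>p\<close> or \<open>q\<close> is linear, and it remains to show that \<open>p\<close> or \<open>q\<close> is linear on the whole space.

  The main tool is \<open>germ_linear_if_other_not_linear\<close>. If \<open>p\<close> is not linear on the span of \<open>x0\<close> and
  \<open>y0\<close>, then by continuity it is not linear on the span of any nearby pair, so \<open>q\<close> is linear on all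
  these spans. A local version of the Cauchy-Pexider functional equation then gives one linear
  functional \<open>L\<close> that agrees with \<open>q\<close> near every nonzero point of the span of \<open>x0\<close> and \<open>y0\<close>.

  Suppose that \<open>q z \<noteq> L z\<close> for some \<open>z\<close>. Since \<open>q\<close> is \<open>L\<close> near \<open>x0\<close>, it is not linear on the span of
  \<open>x0\<close> and \<open>z\<close> (\<open>eq_linear_of_germ\<close>). By the same tool with the roles exchanged, \<open>p\<close> agrees near \<open>z\<close>
  with a linear functional \<open>M\<close>. As \<open>p\<close> is not linear on the span of \<open>x0\<close> and \<open>y0\<close>, there is \<open>y\<close> in this
  span with \<open>p y \<noteq> M y\<close>. On the span of \<open>y\<close> and \<open>z\<close> neither function can be linear: linearity of \<open>p\<close>
  would carry \<open>p = M\<close> from a neighbourhood of \<open>z\<close> to \<open>y\<close>, and linearity of \<open>q\<close> would carry \<open>q = L\<close> from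
  a neighbourhood of \<open>y\<close> to \<open>z\<close>. Hence \<open>q = L\<close> everywhere.
\<close>

section \<open>Linearity on the span of two vectors\<close>

text \<open>Linearity of \<open>q\<close> on the span of \<open>x\<close> and \<open>y\<close>, which may be linearly dependent. For homogeneous \<open>q\<close>
  this says that \<open>q\<close> agrees with a linear functional on the span.\<close>
definition linear_on_pair :: "('a::real_vector \<Rightarrow> real) \<Rightarrow> 'a \<Rightarrow> 'a \<Rightarrow> bool" where
  "linear_on_pair q x y \<longleftrightarrow> (\<forall>a b. q (a *\<^sub>R x + b *\<^sub>R y) = a * q x + b * q y)"

lemma linear_on_pairD:
  "linear_on_pair q x y \<Longrightarrow> q (a *\<^sub>R x + b *\<^sub>R y) = a * q x + b * q y"
  by (simp add: linear_on_pair_def)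

lemma linear_on_pair_commute: "linear_on_pair q x y \<Longrightarrow> linear_on_pair q y x"
  unfolding linear_on_pair_def by (metis add.commute)

lemma eq_linear_of_germ:
  fixes q L :: "'a::real_normed_vector \<Rightarrow> real"
  assumes L: "linear L" and germ: "\<forall>\<^sub>F v in nhds w. q v = L v"
    and lin: "linear_on_pair q w z"
  shows "q z = L z"
proof -
  have "((\<lambda>t::real. w + t *\<^sub>R z) \<longlongrightarrow> w + 0 *\<^sub>R z) (at 0)"
    by (intro tendsto_intros)
  then have "((\<lambda>t::real. w + t *\<^sub>R z) \<longlongrightarrow> w) (at 0)"
    by simp
  then have "\<forall>\<^sub>F t in at (0::real). q (w + t *\<^sub>R z) = L (w + t *\<^sub>R z)"
    using germ unfolding filterlim_iff by blast
  moreover have "\<forall>\<^sub>F t in at (0::real). t \<noteq> 0"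
    by (simp add: eventually_at_filter)
  ultimately have "\<forall>\<^sub>F t in at (0::real). t \<noteq> 0 \<and> q (w + t *\<^sub>R z) = L (w + t *\<^sub>R z)"
    by eventually_elim simp
  then obtain t :: real where t: "t \<noteq> 0" "q (w + t *\<^sub>R z) = L (w + t *\<^sub>R z)"
    using eventually_happens[of _ "at (0::real)"] by (auto simp: trivial_limit_at)
  have "q w + t * q z = L w + t * L z"
    using t(2) linear_on_pairD[OF lin, of 1 t] by (simp add: linear_add[OF L] linear_scale[OF L])
  moreover have "q w = L w"
    using germ by (rule eventually_nhds_x_imp_x)
  ultimately show ?thesis
    using t(1) by simp
qed

lemma eventually_not_linear_on_pair:
  fixes p :: "'a::real_normed_vector \<Rightarrow> real"
  assumes hom: "\<And>t x. p (t *\<^sub>R x) = t * p x"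
    and cont: "\<And>x. x \<noteq> 0 \<Longrightarrow> isCont p x"
    and nl: "\<not> linear_on_pair p x0 y0"
  obtains r where "r > 0"
    and "\<And>x y. dist x x0 < r \<Longrightarrow> dist y y0 < r \<Longrightarrow> \<not> linear_on_pair p x y"
proof -
  obtain a b where ab: "p (a *\<^sub>R x0 + b *\<^sub>R y0) \<noteq> a * p x0 + b * p y0"
    using nl by (auto simp: linear_on_pair_def)
  have p0: "p 0 = 0"
    using hom[of 0 0] by simp
  \<comment> \<open>Continuity at the origin is not assumed, so the three points involved must be nonzero.\<close>
  have nz: "x0 \<noteq> 0" "y0 \<noteq> 0"
    using ab p0 by (auto simp: hom)
  have "a *\<^sub>R x0 + b *\<^sub>R y0 \<noteq> 0"
  proof
    assume z: "a *\<^sub>R x0 + b *\<^sub>R y0 = 0"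
    then have "a *\<^sub>R x0 = (- b) *\<^sub>R y0"
      by (simp add: eq_neg_iff_add_eq_0)
    then have "a * p x0 = - b * p y0"
      by (metis hom)
    with z ab p0 show False
      by simp
  qed
  then have c: "isCont p (a *\<^sub>R x0 + b *\<^sub>R y0)" "isCont p x0" "isCont p y0"
    using cont nz by auto
  define D where "D x y = p (a *\<^sub>R x + b *\<^sub>R y) - (a * p x + b * p y)" for x y
  let ?F = "nhds x0 \<times>\<^sub>F nhds y0"
  have fst: "(fst \<longlongrightarrow> x0) ?F" and snd: "(snd \<longlongrightarrow> y0) ?F"
    by (auto intro: filterlim_fst filterlim_snd)
  have "((\<lambda>z. D (fst z) (snd z)) \<longlongrightarrow> D x0 y0) ?F"
    unfolding D_def
    by (intro tendsto_intros isCont_tendsto_compose[OF c(1)] isCont_tendsto_compose[OF c(2)]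
        isCont_tendsto_compose[OF c(3)] fst snd)
  moreover have "D x0 y0 \<noteq> 0"
    using ab by (simp add: D_def)
  ultimately have "\<forall>\<^sub>F z in ?F. D (fst z) (snd z) \<noteq> 0"
    by (rule tendsto_imp_eventually_ne)
  then obtain P Q where PQ: "eventually P (nhds x0)" "eventually Q (nhds y0)"
    "\<And>x y. P x \<Longrightarrow> Q y \<Longrightarrow> D x y \<noteq> 0"
    by (auto simp: eventually_prod_filter)
  obtain d e where de: "d > 0" "\<And>x. dist x x0 < d \<Longrightarrow> P x" "e > 0" "\<And>y. dist y y0 < e \<Longrightarrow> Q y"
    using PQ(1,2) by (auto simp: eventually_nhds_metric)
  show ?thesis
  proof (rule that[of "min d e"])
    fix x y assume "dist x x0 < min d e" "dist y y0 < min d e"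
    then have "D x y \<noteq> 0"
      using PQ(3) de by simp
    then show "\<not> linear_on_pair p x y"
      by (auto simp: D_def linear_on_pair_def)
  qed (use de in auto)
qed

text \<open>A local Cauchy-Pexider equation. The increments of \<open>q\<close> at \<open>x0\<close> and at \<open>y0\<close> are the same function
  \<open>\<phi>\<close>, which is additive and homogeneous near the origin, hence the restriction of a linear map.
  The homogeneity of \<open>\<phi>\<close> comes from the coefficients in the hypothesis, so no continuity of \<open>q\<close> is needed.\<close>
lemma germ_linear_if_locally_linear_on_pair:
  fixes q :: "'a::real_normed_vector \<Rightarrow> real"
  assumes hom: "\<And>t x. q (t *\<^sub>R x) = t * q x"
    and r: "r > 0"
    and lin: "\<And>x y. dist x x0 < r \<Longrightarrow> dist y y0 < r \<Longrightarrow> linear_on_pair q x y"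
  obtains L where "linear L"
    and "\<And>a b. a *\<^sub>R x0 + b *\<^sub>R y0 \<noteq> 0 \<Longrightarrow> \<forall>\<^sub>F v in nhds (a *\<^sub>R x0 + b *\<^sub>R y0). q v = L v"
proof -
  define \<phi> where "\<phi> h = q (x0 + h) - q x0" for h
  have pair: "q (a *\<^sub>R (x0 + h) + b *\<^sub>R (y0 + k)) = a * q (x0 + h) + b * q (y0 + k)"
    if "norm h < r" "norm k < r" for a b h k
    by (rule linear_on_pairD, rule lin) (use that in \<open>auto simp: dist_norm\<close>)
  \<comment> \<open>The increment is moved from one summand to the other.\<close>
  have shift: "\<phi> h = q (y0 + h) - q y0" if "norm h < r" for h
    using pair[of h 0 1 1] pair[of 0 h 1 1] that r
    by (simp add: \<phi>_def algebra_simps)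
  have scale: "\<phi> (t *\<^sub>R h) = t * \<phi> h" if "norm h < r" "norm (t *\<^sub>R h) < r" for t h
    using pair[of h 0 t 1] pair[of 0 "t *\<^sub>R h" t 1] shift[of "t *\<^sub>R h"] that r
    by (simp add: \<phi>_def algebra_simps)
  have add: "\<phi> (h + k) = \<phi> h + \<phi> k" if "norm h < r" "norm k < r" "norm (h + k) < r" for h k
    using pair[of h k 1 1] pair[of "h + k" 0 1 1] shift[of k] that r
    by (simp add: \<phi>_def algebra_simps)
  define \<epsilon> where "\<epsilon> h = r / (norm h + 1)" for h :: 'a
  have \<epsilon>: "\<epsilon> h > 0" "norm (\<epsilon> h *\<^sub>R h) < r" for h
  proof -
    have pos: "norm h + 1 > 0"
      by (simp add: add_nonneg_pos)
    then show "\<epsilon> h > 0"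
      using r by (simp add: \<epsilon>_def)
    have "norm (\<epsilon> h *\<^sub>R h) = r * norm h / (norm h + 1)"
      using r pos by (simp add: \<epsilon>_def abs_of_pos)
    then show "norm (\<epsilon> h *\<^sub>R h) < r"
      using r pos by (simp add: divide_less_eq algebra_simps)
  qed
  define L where "L h = \<phi> (\<epsilon> h *\<^sub>R h) / \<epsilon> h" for h
  have L_eq: "L h = \<phi> (e *\<^sub>R h) / e" if "e > 0" "norm (e *\<^sub>R h) < r" for e h
    using scale[of "\<epsilon> h *\<^sub>R h" "e / \<epsilon> h"] \<epsilon>[of h] that by (simp add: L_def field_simps)
  have L_\<phi>: "L h = \<phi> h" if "norm h < r" for h
    using L_eq[of 1 h] that by simp
  have small: "norm (e *\<^sub>R v) < r" if "e > 0" "e \<le> \<epsilon> v" for e v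
  proof -
    have "norm (e *\<^sub>R v) \<le> norm (\<epsilon> v *\<^sub>R v)"
      using that by (simp add: mult_right_mono)
    then show ?thesis
      using \<epsilon>(2)[of v] by simp
  qed
  have linL: "linear L"
  proof
    fix h k
    define e where "e = min (\<epsilon> (h + k)) (min (\<epsilon> h) (\<epsilon> k))"
    have e: "e > 0"
      using \<epsilon>(1) by (simp add: e_def)
    have s: "norm (e *\<^sub>R h) < r" "norm (e *\<^sub>R k) < r" "norm (e *\<^sub>R (h + k)) < r"
      by (rule small[OF e], simp add: e_def)+
    show "L (h + k) = L h + L k"
      using L_eq[OF e s(1)] L_eq[OF e s(2)] L_eq[OF e s(3)] add[of "e *\<^sub>R h" "e *\<^sub>R k"] s
      by (simp add: scaleR_right_distrib add_divide_distrib)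
  next
    fix t h
    define e where "e = min (\<epsilon> h) (\<epsilon> (t *\<^sub>R h))"
    have e: "e > 0"
      using \<epsilon>(1) by (simp add: e_def)
    have s: "norm (e *\<^sub>R h) < r" "norm (e *\<^sub>R (t *\<^sub>R h)) < r"
      by (rule small[OF e], simp add: e_def)+
    show "L (t *\<^sub>R h) = t *\<^sub>R L h"
      using L_eq[OF e s(1)] L_eq[OF e s(2)] scale[of "e *\<^sub>R h" t] s
      by (simp add: mult.commute)
  qed
  have L_x0: "L x0 = q x0"
  proof -
    have "\<phi> (\<epsilon> x0 *\<^sub>R x0) = q ((1 + \<epsilon> x0) *\<^sub>R x0) - q x0"
      by (simp add: \<phi>_def scaleR_left_distrib)
    also have "\<dots> = \<epsilon> x0 * q x0"
      by (simp only: hom) (simp add: algebra_simps)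
    finally show ?thesis
      using \<epsilon>(1)[of x0] by (simp add: L_def)
  qed
  have L_y0: "L y0 = q y0"
  proof -
    have "\<phi> (\<epsilon> y0 *\<^sub>R y0) = q ((1 + \<epsilon> y0) *\<^sub>R y0) - q y0"
      using shift[OF \<epsilon>(2)] by (simp add: scaleR_left_distrib)
    also have "\<dots> = \<epsilon> y0 * q y0"
      by (simp only: hom) (simp add: algebra_simps)
    finally show ?thesis
      using \<epsilon>(1)[of y0] by (simp add: L_def)
  qed
  have q_x0: "q (x0 + h) = L (x0 + h)" if "norm h < r" for h
    using L_\<phi>[OF that] L_x0 by (simp add: linear_add[OF linL] \<phi>_def)
  have q_y0: "q (y0 + h) = L (y0 + h)" if "norm h < r" for h
    using L_\<phi>[OF that] L_y0 shift[OF that] by (simp add: linear_add[OF linL])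
  have q_eq: "q (a *\<^sub>R (x0 + h) + b *\<^sub>R (y0 + k)) = L (a *\<^sub>R (x0 + h) + b *\<^sub>R (y0 + k))"
    if "norm h < r" "norm k < r" for a b h k
    unfolding pair[OF that] q_x0[OF that(1)] q_y0[OF that(2)]
    by (simp only: linear_add[OF linL] linear_scale[OF linL] real_scaleR_def)
  show ?thesis
  proof (rule that[OF linL])
    fix a b
    assume "a *\<^sub>R x0 + b *\<^sub>R y0 \<noteq> 0"
    then consider "a \<noteq> 0" | "b \<noteq> 0"
      by fastforce
    then show "\<forall>\<^sub>F v in nhds (a *\<^sub>R x0 + b *\<^sub>R y0). q v = L v"
    proof cases
      case 1
      have "q v = L v" if v: "dist v (a *\<^sub>R x0 + b *\<^sub>R y0) < r * \<bar>a\<bar>" for v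
      proof -
        define h where "h = (1 / a) *\<^sub>R (v - (a *\<^sub>R x0 + b *\<^sub>R y0))"
        have "norm h < r"
          using v 1 by (simp add: h_def dist_norm pos_divide_less_eq)
        moreover have "v = a *\<^sub>R (x0 + h) + b *\<^sub>R (y0 + 0)"
          using 1 by (simp add: h_def algebra_simps)
        ultimately show ?thesis
          using q_eq[of h 0 a b] r by simp
      qed
      then show ?thesis
        unfolding eventually_nhds_metric using r 1 by (intro exI[of _ "r * \<bar>a\<bar>"]) auto
    next
      case 2
      have "q v = L v" if v: "dist v (a *\<^sub>R x0 + b *\<^sub>R y0) < r * \<bar>b\<bar>" for v
      proof -
        define h where "h = (1 / b) *\<^sub>R (v - (a *\<^sub>R x0 + b *\<^sub>R y0))"
        have "norm h < r"
          using v 2 by (simp add: h_def dist_norm pos_divide_less_eq)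
        moreover have "v = a *\<^sub>R (x0 + 0) + b *\<^sub>R (y0 + h)"
          using 2 by (simp add: h_def algebra_simps)
        ultimately show ?thesis
          using q_eq[of 0 h a b] r by simp
      qed
      then show ?thesis
        unfolding eventually_nhds_metric using r 2 by (intro exI[of _ "r * \<bar>b\<bar>"]) auto
    qed
  qed
qed

lemma germ_linear_if_other_not_linear:
  fixes p q :: "'a::real_normed_vector \<Rightarrow> real"
  assumes hom: "\<And>t x. p (t *\<^sub>R x) = t * p x" "\<And>t x. q (t *\<^sub>R x) = t * q x"
    and cont: "\<And>x. x \<noteq> 0 \<Longrightarrow> isCont p x"
    and either: "\<And>x y. linear_on_pair p x y \<or> linear_on_pair q x y"
    and nl: "\<not> linear_on_pair p x0 y0"
  obtains L where "linear L"
    and "\<And>a b. a *\<^sub>R x0 + b *\<^sub>R y0 \<noteq> 0 \<Longrightarrow> \<forall>\<^sub>F v in nhds (a *\<^sub>R x0 + b *\<^sub>R y0). q v = L v"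
proof -
  obtain r where r: "r > 0"
    "\<And>x y. dist x x0 < r \<Longrightarrow> dist y y0 < r \<Longrightarrow> \<not> linear_on_pair p x y"
    using eventually_not_linear_on_pair[OF hom(1) cont nl] by blast
  show ?thesis
    by (rule germ_linear_if_locally_linear_on_pair[where q = q and r = r and ?x0.0 = x0 and ?y0.0 = y0])
      (use r either hom(2) that in blast)+
qed

section \<open>From pairs of vectors to the whole space\<close>

theorem linear_or_linear_if_linear_on_pairs:
  fixes p q :: "'a::real_normed_vector \<Rightarrow> real"
  assumes hom: "\<And>t x. p (t *\<^sub>R x) = t * p x" "\<And>t x. q (t *\<^sub>R x) = t * q x"
    and cont: "\<And>x. x \<noteq> 0 \<Longrightarrow> isCont p x" "\<And>x. x \<noteq> 0 \<Longrightarrow> isCont q x"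
    and either: "\<And>x y. linear_on_pair p x y \<or> linear_on_pair q x y"
  shows "linear p \<or> linear q"
proof (cases "\<forall>x y. linear_on_pair p x y")
  case True
  then have "p (x + y) = p x + p y" for x y
    using linear_on_pairD[of p x y 1 1] by simp
  then have "linear p"
    by (intro linearI) (auto simp: hom)
  then show ?thesis ..
next
  case False
  then obtain x0 y0 where nl: "\<not> linear_on_pair p x0 y0"
    by auto
  obtain L where L: "linear L"
    and germL: "\<And>a b. a *\<^sub>R x0 + b *\<^sub>R y0 \<noteq> 0 \<Longrightarrow> \<forall>\<^sub>F v in nhds (a *\<^sub>R x0 + b *\<^sub>R y0). q v = L v"
    using germ_linear_if_other_not_linear[OF hom cont(1) either nl] by blast
  have p0: "p 0 = 0" and q0: "q 0 = 0"
    using hom[of 0 0] by simp_all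
  have "x0 \<noteq> 0"
    using nl p0 by (auto simp: linear_on_pair_def hom)
  then have germ_x0: "\<forall>\<^sub>F v in nhds x0. q v = L v"
    using germL[of 1 0] by simp
  have "q z = L z" for z
  proof (rule ccontr)
    assume z: "q z \<noteq> L z"
    then have "z \<noteq> 0"
      using q0 linear_0[OF L] by auto
    have "\<not> linear_on_pair q x0 z"
      using eq_linear_of_germ[OF L germ_x0] z by blast
    moreover have "linear_on_pair q x y \<or> linear_on_pair p x y" for x y
      using either by blast
    ultimately obtain M where M: "linear M"
      and germM: "\<And>a b. a *\<^sub>R x0 + b *\<^sub>R z \<noteq> 0 \<Longrightarrow> \<forall>\<^sub>F v in nhds (a *\<^sub>R x0 + b *\<^sub>R z). p v = M v"
      using germ_linear_if_other_not_linear[OF hom(2) hom(1) cont(2)] by blast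
    have germ_z: "\<forall>\<^sub>F v in nhds z. p v = M v"
      using germM[of 0 1] \<open>z \<noteq> 0\<close> by simp
    have "\<exists>a b. p (a *\<^sub>R x0 + b *\<^sub>R y0) \<noteq> M (a *\<^sub>R x0 + b *\<^sub>R y0)"
    proof (rule ccontr)
      assume "\<not> ?thesis"
      then have *: "p (a *\<^sub>R x0 + b *\<^sub>R y0) = M (a *\<^sub>R x0 + b *\<^sub>R y0)" for a b
        by blast
      have "p x0 = M x0" "p y0 = M y0"
        using *[of 1 0] *[of 0 1] by simp_all
      then have "linear_on_pair p x0 y0"
        unfolding linear_on_pair_def * by (simp add: linear_add[OF M] linear_scale[OF M])
      with nl show False ..
    qed
    then obtain a b where ab: "p (a *\<^sub>R x0 + b *\<^sub>R y0) \<noteq> M (a *\<^sub>R x0 + b *\<^sub>R y0)"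
      by blast
    define y where "y = a *\<^sub>R x0 + b *\<^sub>R y0"
    have y: "p y \<noteq> M y"
      using ab by (simp add: y_def)
    then have "y \<noteq> 0"
      using p0 linear_0[OF M] by auto
    then have germ_y: "\<forall>\<^sub>F v in nhds y. q v = L v"
      using germL[of a b] by (simp add: y_def)
    from either[of z y] show False
    proof
      assume "linear_on_pair p z y"
      with eq_linear_of_germ[OF M germ_z] y show False
        by blast
    next
      assume "linear_on_pair q z y"
      with eq_linear_of_germ[OF L germ_y] z show False
        by (blast dest: linear_on_pair_commute)
    qed
  qed
  then have "q = L"
    by blast
  with L show ?thesis
    by simp
qed

section \<open>Functions on the sphere\<close>

text \<open>The positively homogeneous extension, of degree one, of a function on the unit sphere. Its value
  at the origin is zero, since the norm vanishes there.\<close>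
definition homogeneous_ext :: "('a::real_normed_vector \<Rightarrow> real) \<Rightarrow> 'a \<Rightarrow> real" where
  "homogeneous_ext h x = norm x * h (sgn x)"

lemma homogeneous_ext_sphere: "norm u = 1 \<Longrightarrow> homogeneous_ext h u = h u"
  by (simp add: homogeneous_ext_def sgn_div_norm)

lemma homogeneous_ext_scaleR:
  assumes odd: "\<And>u. h (- u) = - h u"
  shows "homogeneous_ext h (t *\<^sub>R x) = t * homogeneous_ext h x"
  by (cases t "0::real" rule: linorder_cases)
    (simp_all add: homogeneous_ext_def sgn_scaleR odd)

lemma isCont_homogeneous_ext:
  fixes h :: "'a::real_normed_vector \<Rightarrow> real"
  assumes "continuous_on (sphere 0 1) h" "x \<noteq> 0"
  shows "isCont (homogeneous_ext h) x"
proof -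
  have "continuous_on (- {0}) (\<lambda>x::'a. h (sgn x))"
    by (rule continuous_on_compose2[OF assms(1)])
      (auto simp: norm_sgn sgn_zero_iff split: if_splits intro!: continuous_on_sgn continuous_on_id)
  then have "continuous_on (- {0}) (homogeneous_ext h)"
    unfolding homogeneous_ext_def by (intro continuous_intros)
  then show ?thesis
    using assms(2) by (simp add: continuous_on_eq_continuous_at open_Compl)
qed

lemma linear_on_pair_homogeneous_ext:
  fixes h :: "'a::real_inner \<Rightarrow> real"
  assumes S: "subspace S" and xy: "x \<in> S" "y \<in> S"
    and eq: "\<And>u. u \<in> S \<Longrightarrow> norm u = 1 \<Longrightarrow> h u = c \<bullet> u"
  shows "linear_on_pair (homogeneous_ext h) x y"
proof -
  have *: "homogeneous_ext h v = c \<bullet> v" if "v \<in> S" for v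
  proof (cases "v = 0")
    case False
    then have "h (sgn v) = c \<bullet> sgn v"
      using that S by (intro eq) (simp_all add: sgn_div_norm subspace_scale)
    with False show ?thesis
      by (simp add: homogeneous_ext_def sgn_div_norm)
  qed (simp add: homogeneous_ext_def)
  have "a *\<^sub>R x + b *\<^sub>R y \<in> S" for a b
    using S xy by (simp add: subspace_add subspace_scale)
  then show ?thesis
    using xy by (simp add: linear_on_pair_def * inner_add_right)
qed

lemma ex_subspace_superset_dim:
  fixes A :: "'a::euclidean_space set"
  assumes "dim A \<le> k" "k \<le> DIM('a)"
  obtains S where "subspace S" "dim S = k" "A \<subseteq> S"
proof -
  have "\<exists>T. A \<subseteq> T \<and> dim T = k"
    using assms
  proof (induction k rule: dec_induct)
    case base
    then show ?case by blast
  next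
    case (step m)
    then obtain T where T: "A \<subseteq> T" "dim T = m"
      by auto
    have "span T \<noteq> UNIV"
      using T step.prems dim_eq_full[of T] by auto
    then obtain z where "z \<notin> span T"
      by blast
    then have "dim (insert z T) = Suc m"
      using T by (simp add: dim_insert)
    with T show ?case
      by blast
  qed
  then obtain T where "A \<subseteq> T" "dim T = k"
    by blast
  then show ?thesis
    using that[of "span T"] by (simp add: order_trans[OF _ span_superset])
qed

theorem theorem1p3:
  fixes f g :: "real ^ 'n \<Rightarrow> real" and k :: nat
  assumes "2 \<le> k" and "k \<le> CARD('n) - 1"
    and "continuous_on (sphere 0 1) f" and "continuous_on (sphere 0 1) g"
    and "\<And>\<alpha> :: (real ^ 'n) set. subspace \<alpha> \<Longrightarrow> dim \<alpha> = k \<Longrightarrow>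
          \<exists>a\<in>\<alpha>. (\<forall>u \<in> \<alpha> \<inter> sphere 0 1. f (- u) + a \<bullet> u = g u) \<or>
                (\<forall>u \<in> \<alpha> \<inter> sphere 0 1. f u + a \<bullet> u = g u)"
  shows "\<exists>b :: real ^ 'n. (\<forall>u \<in> sphere 0 1. g u = f u + b \<bullet> u) \<or>
                          (\<forall>u \<in> sphere 0 1. g u = f (- u) + b \<bullet> u)"
proof -
  define P where "P u = (g u - g (- u)) - (f u - f (- u))" for u
  define Q where "Q u = (g u - g (- u)) + (f u - f (- u))" for u
  have plane: "\<exists>S a. subspace S \<and> x \<in> S \<and> y \<in> S \<and>
      ((\<forall>u\<in>S. norm u = 1 \<longrightarrow> g u = f (- u) + a \<bullet> u) \<or> (\<forall>u\<in>S. norm u = 1 \<longrightarrow> g u = f u + a \<bullet> u))"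
    for x y
  proof -
    have "dim {x, y} \<le> card {x, y}"
      by (rule dim_le_card') simp
    also have "\<dots> \<le> 2"
      by (simp add: card_insert_if)
    also have "2 \<le> k"
      by fact
    finally have "dim {x, y} \<le> k" .
    moreover have "k \<le> DIM(real ^ 'n)"
      using assms(2) by simp
    ultimately obtain S where S: "subspace S" "dim S = k" "{x, y} \<subseteq> S"
      by (rule ex_subspace_superset_dim)
    obtain a where "(\<forall>u \<in> S \<inter> sphere 0 1. f (- u) + a \<bullet> u = g u) \<or>
                (\<forall>u \<in> S \<inter> sphere 0 1. f u + a \<bullet> u = g u)"
      using assms(5)[OF S(1,2)] by blast
    then have "(\<forall>u\<in>S. norm u = 1 \<longrightarrow> g u = f (- u) + a \<bullet> u) \<or>
        (\<forall>u\<in>S. norm u = 1 \<longrightarrow> g u = f u + a \<bullet> u)"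
      by auto
    with S show ?thesis
      by blast
  qed
  have even: "g u + g (- u) = f u + f (- u)" if "norm u = 1" for u
  proof -
    obtain S a where S: "subspace S" "u \<in> S" and
      disj: "(\<forall>u\<in>S. norm u = 1 \<longrightarrow> g u = f (- u) + a \<bullet> u) \<or>
        (\<forall>u\<in>S. norm u = 1 \<longrightarrow> g u = f u + a \<bullet> u)"
      using plane[of u u] by blast
    have "- u \<in> S" "norm (- u) = 1"
      using S that by (simp_all add: subspace_neg)
    with disj S(2) that show ?thesis
      by fastforce
  qed
  have either: "linear_on_pair (homogeneous_ext P) x y \<or> linear_on_pair (homogeneous_ext Q) x y"
    for x y
  proof -
    obtain S a where S: "subspace S" "x \<in> S" "y \<in> S" and
      disj: "(\<forall>u\<in>S. norm u = 1 \<longrightarrow> g u = f (- u) + a \<bullet> u) \<or>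
        (\<forall>u\<in>S. norm u = 1 \<longrightarrow> g u = f u + a \<bullet> u)"
      using plane[of x y] by blast
    have neg: "- u \<in> S" if "u \<in> S" for u
      using S(1) that by (rule subspace_neg)
    from disj show ?thesis
    proof
      assume *: "\<forall>u\<in>S. norm u = 1 \<longrightarrow> g u = f (- u) + a \<bullet> u"
      have "Q u = (2 *\<^sub>R a) \<bullet> u" if "u \<in> S" "norm u = 1" for u
        using *[rule_format, of u] *[rule_format, of "- u"] neg that by (simp add: Q_def)
      then show ?thesis
        using linear_on_pair_homogeneous_ext[OF S] by blast
    next
      assume *: "\<forall>u\<in>S. norm u = 1 \<longrightarrow> g u = f u + a \<bullet> u"
      have "P u = (2 *\<^sub>R a) \<bullet> u" if "u \<in> S" "norm u = 1" for u
        using *[rule_format, of u] *[rule_format, of "- u"] neg that by (simp add: P_def)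
      then show ?thesis
        using linear_on_pair_homogeneous_ext[OF S] by blast
    qed
  qed
  have neg_cont: "continuous_on (sphere 0 1) (\<lambda>u. h (- u))"
    if "continuous_on (sphere 0 1) h" for h :: "real ^ 'n \<Rightarrow> real"
    by (rule continuous_on_compose2[OF that]) (auto intro!: continuous_intros)
  have contP: "continuous_on (sphere 0 1) P" and contQ: "continuous_on (sphere 0 1) Q"
    unfolding P_def Q_def by (intro continuous_intros assms(3,4) neg_cont)+
  have odd: "P (- u) = - P u" "Q (- u) = - Q u" for u
    by (simp_all add: P_def Q_def)
  have ex_inner: "\<exists>c. \<forall>u. norm u = 1 \<longrightarrow> h u = c \<bullet> u"
    if "linear (homogeneous_ext h)" for h :: "real ^ 'n \<Rightarrow> real"
    using adjoint_works[OF that, of _ 1] homogeneous_ext_sphere[of _ h]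
    by (metis inner_commute inner_real_def mult.right_neutral)
  have "linear (homogeneous_ext P) \<or> linear (homogeneous_ext Q)"
    by (intro linear_or_linear_if_linear_on_pairs homogeneous_ext_scaleR odd either
        isCont_homogeneous_ext contP contQ)
  then show ?thesis
  proof
    assume "linear (homogeneous_ext P)"
    then obtain c where c: "\<And>u. norm u = 1 \<Longrightarrow> P u = c \<bullet> u"
      using ex_inner by blast
    have "g u = f u + (c /\<^sub>R 2) \<bullet> u" if "norm u = 1" for u
      using c[OF that] even[OF that] by (simp add: P_def)
    then show ?thesis
      by (intro exI[of _ "c /\<^sub>R 2"]) simp
  next
    assume "linear (homogeneous_ext Q)"
    then obtain c where c: "\<And>u. norm u = 1 \<Longrightarrow> Q u = c \<bullet> u"
      using ex_inner by blast
    have "g u = f (- u) + (c /\<^sub>R 2) \<bullet> u" if "norm u = 1" for u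
      using c[OF that] even[OF that] by (simp add: Q_def)
    then show ?thesis
      by (intro exI[of _ "c /\<^sub>R 2"]) simp
  qed
qed

end
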